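(* Let $\mathcal{V}=(V_i)_{i\in I}$ be a $2$-weakly $D$-invariant collection of random vectors $V_i\in\mathbb{C}^{2\ell_i+1}$, $\ell_i\in\frac12\mathbb{N}$. Then $\mathbb{E}\{V_i\}=0$ whenever $\ell_i\neq0$, and the correlation structure satisfies the following identities, for all $i,j\in I$: $$\mathbb{E}\left\{V_i(\overline{V_j})^T\right\}=\frac{\delta_{\ell_i,\ell_j}}{2\ell_i+1}\,\mathbb{1}_{(2\ell_i+1)}\left(\mathbb{E}\{\overline{\langle V_i,V_j\rangle}\}\right),$$ $$\mathbb{E}\left\{V_i(V_j)^T\right\}=\frac{\delta_{\ell_i,\ell_j}}{2\ell_i+1}\,\varepsilon(\ell_i)\left(\sum_{k=-\ell_i}^{\ell_i}(-1)^{\ell_i+k}\,\mathbb{E}\{\langle e_k,V_i\rangle\langle e_{-k},V_j\rangle\}\right).$$ In particular, $V_i$ and $V_j$ are uncorrelated if $\ell_i\neq\ell_j$. Moreover, the $m$-th component of $V_i$ is correlated only with the $m$-th and the $(-m)$-th components of $V_j$, and the correlation depends only on the parity of $\ell_i-m$. Finally, the variance of each component of $V_i$ depends only on $\ell_i$.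
   Context: $\frac12\mathbb{N}=\{0,\frac12,1,\dots\}$. Coordinates of $\mathbb{C}^{2\ell+1}$ are indexed by $m\in\{-\ell,-\ell+1,\dots,\ell\}$ with canonical basis $e_m$; $\langle v,w\rangle=\overline{v}^Tw$. $\varepsilon(\ell)\in\mathbb{C}^{(2\ell+1)\times(2\ell+1)}$ is the matrix $\varepsilon(\ell)_{m,m'}=\delta_{-m,m'}(-1)^{\ell-m}$, and $\mathbb{1}_{(2\ell+1)}$ is the identity matrix. If $\ell_i\neq\ell_j$ the right-hand sides of the identities are zero matrices. The Wigner matrix $D^\ell=(D^\ell_{m,s})_{m,s}:SU(2)\to U(2\ell+1)$ is the unitary representation defined as follows: with $\psi^\ell_m(z_0,z_1)=\binom{2\ell}{\ell+m}^{1/2}z_0^{\ell+m}z_1^{\ell-m}$ and $g=\begin{pmatrix}\alpha&-\overline\beta\\ \beta&\overline\alpha\end{pmatrix}\in SU(2)$, $\sum_m\psi^\ell_m(z_0,z_1)D^\ell_{m,s}(g)=\psi^\ell_s(\overline\alpha z_0+\overline\beta z_1,-\beta z_0+\alpha z_1)$ for all $z_0,z_1\in\mathbb{C}$. Random vectors $V,V'\in\mathbb{C}^N$ are $2$-weakly equivalent, $V\sim_{\text{2-w}}V'$, if $\mathbb{E}V=\mathbb{E}V'$, $\mathbb{E}\{V\overline{V}^T\}=\mathbb{E}\{V'\overline{V'}^T\}$ and $\mathbb{E}\{VV^T\}=\mathbb{E}\{V'(V')^T\}$. The collection $(V_i)_{i\in I}$ is $2$-weakly $D$-invariant if $(V_i,V_j)\sim_{\text{2-w}}(D^{\ell_i}(g)V_i,D^{\ell_j}(g)V_j)$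 for all $i,j\in I$ and $g\in SU(2)$. Complex random variables $U,W$ are uncorrelated if $\mathbb{E}\{UW\}=\mathbb{E}U\,\mathbb{E}W$ and $\mathbb{E}\{U\overline W\}=\mathbb{E}U\,\overline{\mathbb{E}W}$; random vectors are uncorrelated if all pairs of their components are.
   Formalization: The sign (-1)^{ℓ_i+k} is corrected to (-1)^{ℓ_i-k} (printed one fails for half-integer ℓ_i); variance is shown independent of m for each fixed i; in the parity claim, covariance of m with -m and pseudo-covariance of m with m are compared only for nonzero m, since for m=0 these indices coincide. *)

theory Defs
  imports "HOL-Probability.Probability"
begin

section \<open>Half-integers, indices and vectors\<close>

definition half_nats :: "real set" where
  "half_nats = {real n / 2 | n. True}"

text \<open>Vectors of \<open>\<complex>\<^bsup>2l+1\<^esup>\<close> are functions \<^typ>\<open>real \<Rightarrow> complex\<close> of which only the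
  values on \<open>idx l = {-l, -l+1, \<dots>, l}\<close> matter; matrices are treated in the same way.\<close>

definition idx :: "real \<Rightarrow> real set" where
  "idx l = {- l + real k | k. - l + real k \<le> l}"

text \<open>The exponents below are natural numbers presented as differences of half-integers.\<close>

definition nat_of_real :: "real \<Rightarrow> nat" where
  "nat_of_real x = nat \<lfloor>x\<rfloor>"

definition hinner :: "real \<Rightarrow> (real \<Rightarrow> complex) \<Rightarrow> (real \<Rightarrow> complex) \<Rightarrow> complex" where
  "hinner l v w = (\<Sum>m\<in>idx l. cnj (v m) * w m)"

definition basis_vec :: "real \<Rightarrow> real \<Rightarrow> complex" where
  "basis_vec m = (\<lambda>m'. of_bool (m' = m))"

definition mat_vec :: "real \<Rightarrow> (real \<Rightarrow> real \<Rightarrow> complex) \<Rightarrow> (real \<Rightarrow> complex) \<Rightarrow> real \<Rightarrow> complex" where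
  "mat_vec l A v = (\<lambda>m. \<Sum>s\<in>idx l. A m s * v s)"

definition id_mat :: "real \<Rightarrow> real \<Rightarrow> complex" where
  "id_mat m m' = of_bool (m = m')"

text \<open>\<open>eps l\<close> is antisymmetric when \<open>l\<close> is a proper half-integer. In that case \<open>(-1)\<^bsup>l-m\<^esup>\<close> and
  \<open>(-1)\<^bsup>l+m\<^esup>\<close> differ by a sign, so the two must not be interchanged.\<close>

definition eps :: "real \<Rightarrow> real \<Rightarrow> real \<Rightarrow> complex" where
  "eps l m m' = of_bool (m' = - m) * (- 1) ^ nat_of_real (l - m)"


section \<open>Wigner matrices\<close>

definition SU2 :: "(complex^2^2) set" where
  "SU2 = {g. g ** (\<chi> i j. cnj (g $ j $ i)) = mat 1 \<and> det g = 1}"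

definition psi :: "real \<Rightarrow> real \<Rightarrow> complex \<Rightarrow> complex \<Rightarrow> complex" where
  "psi l m z0 z1 = of_real (sqrt (real (nat_of_real (2 * l) choose nat_of_real (l + m))))
     * z0 ^ nat_of_real (l + m) * z1 ^ nat_of_real (l - m)"

definition is_wigner :: "real \<Rightarrow> complex^2^2 \<Rightarrow> (real \<Rightarrow> real \<Rightarrow> complex) \<Rightarrow> bool" where
  "is_wigner l g D \<longleftrightarrow>
     (let \<alpha> = g $ 1 $ 1; \<beta> = g $ 2 $ 1 in
      \<forall>s\<in>idx l. \<forall>z0 z1. (\<Sum>m\<in>idx l. psi l m z0 z1 * D m s)
        = psi l s (cnj \<alpha> * z0 + cnj \<beta> * z1) (- \<beta> * z0 + \<alpha> * z1))"

text \<open>The entries outside the index range are set to \<open>0\<close> to make the matrix unique as a function.\<close>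

definition wigner :: "real \<Rightarrow> complex^2^2 \<Rightarrow> real \<Rightarrow> real \<Rightarrow> complex" where
  "wigner l g = (THE D. is_wigner l g D \<and> (\<forall>m s. m \<notin> idx l \<or> s \<notin> idx l \<longrightarrow> D m s = 0))"


section \<open>Second-order structure of random vectors\<close>

text \<open>Square integrability is what makes all the expectations below meaningful.\<close>

definition second_order_random_vector :: "'w measure \<Rightarrow> 'a set \<Rightarrow> ('w \<Rightarrow> 'a \<Rightarrow> complex) \<Rightarrow> bool" where
  "second_order_random_vector M A V \<longleftrightarrow>
     (\<forall>a\<in>A. (\<lambda>w. V w a) \<in> borel_measurable M \<and> integrable M (\<lambda>w. (cmod (V w a))\<^sup>2))"

definition two_weakly_equiv ::
  "'w measure \<Rightarrow> 'v measure \<Rightarrow> 'a set \<Rightarrow> ('w \<Rightarrow> 'a \<Rightarrow> complex) \<Rightarrow> ('v \<Rightarrow> 'a \<Rightarrow> complex) \<Rightarrow> bool" where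
  "two_weakly_equiv M M' A V V' \<longleftrightarrow>
     (\<forall>a\<in>A. (LINT w|M. V w a) = (LINT w|M'. V' w a)) \<and>
     (\<forall>a\<in>A. \<forall>b\<in>A. (LINT w|M. V w a * cnj (V w b)) = (LINT w|M'. V' w a * cnj (V' w b))) \<and>
     (\<forall>a\<in>A. \<forall>b\<in>A. (LINT w|M. V w a * V w b) = (LINT w|M'. V' w a * V' w b))"

text \<open>The joint vector \<open>(V\<^sub>i, V\<^sub>j)\<close> is indexed by the disjoint sum of the two index sets.\<close>

definition two_weakly_D_invariant ::
  "'w measure \<Rightarrow> 'i set \<Rightarrow> ('i \<Rightarrow> real) \<Rightarrow> ('i \<Rightarrow> 'w \<Rightarrow> real \<Rightarrow> complex) \<Rightarrow> bool" where
  "two_weakly_D_invariant M I l V \<longleftrightarrow>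
     (\<forall>i\<in>I. \<forall>j\<in>I. \<forall>g\<in>SU2.
        two_weakly_equiv M M (idx (l i) <+> idx (l j))
          (\<lambda>w. case_sum (V i w) (V j w))
          (\<lambda>w. case_sum (mat_vec (l i) (wigner (l i) g) (V i w))
                        (mat_vec (l j) (wigner (l j) g) (V j w))))"

definition uncorrelated :: "'w measure \<Rightarrow> ('w \<Rightarrow> complex) \<Rightarrow> ('w \<Rightarrow> complex) \<Rightarrow> bool" where
  "uncorrelated M U W \<longleftrightarrow>
     (LINT w|M. U w * W w) = (LINT w|M. U w) * (LINT w|M. W w) \<and>
     (LINT w|M. U w * cnj (W w)) = (LINT w|M. U w) * cnj (LINT w|M. W w)"

definition uncorrelated_vec ::
  "'w measure \<Rightarrow> 'a set \<Rightarrow> 'b set \<Rightarrow> ('w \<Rightarrow> 'a \<Rightarrow> complex) \<Rightarrow> ('w \<Rightarrow> 'b \<Rightarrow> complex) \<Rightarrow> bool" where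
  "uncorrelated_vec M A B V W \<longleftrightarrow>
     (\<forall>a\<in>A. \<forall>b\<in>B. uncorrelated M (\<lambda>w. V w a) (\<lambda>w. W w b))"

text \<open>The two kinds of correlation of complex random variables; \<^const>\<open>uncorrelated\<close> says that both
  vanish.\<close>

definition covar :: "'w measure \<Rightarrow> ('w \<Rightarrow> complex) \<Rightarrow> ('w \<Rightarrow> complex) \<Rightarrow> complex" where
  "covar M U W = (LINT w|M. U w * cnj (W w)) - (LINT w|M. U w) * cnj (LINT w|M. W w)"

definition pseudo_covar :: "'w measure \<Rightarrow> ('w \<Rightarrow> complex) \<Rightarrow> ('w \<Rightarrow> complex) \<Rightarrow> complex" where
  "pseudo_covar M U W = (LINT w|M. U w * W w) - (LINT w|M. U w) * (LINT w|M. W w)"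

definition complex_variance :: "'w measure \<Rightarrow> ('w \<Rightarrow> complex) \<Rightarrow> real" where
  "complex_variance M U = (LINT w|M. (cmod (U w - (LINT w|M. U w)))\<^sup>2)"


section \<open>Well-definedness of the Wigner matrices\<close>

lemma idx_half: "idx (real n / 2) = (\<lambda>k. real k - real n / 2) ` {..n}"
proof -
  have "- (real n / 2) + real k \<le> real n / 2 \<longleftrightarrow> k \<le> n" for k by (simp add: field_simps)
  then show ?thesis unfolding idx_def by auto
qed

lemma sum_idx_half: "(\<Sum>m\<in>idx (real n / 2). f m) = (\<Sum>k\<le>n. f (real k - real n / 2))"
  unfolding idx_half by (subst sum.reindex) (auto simp: inj_on_def)

lemma nat_of_real_of_nat: "nat_of_real (real k) = k"
  unfolding nat_of_real_def by simp

lemma psi_half: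
  assumes "k \<le> n"
  shows "psi (real n / 2) (real k - real n / 2) z0 z1 =
    of_real (sqrt (real (n choose k))) * z0 ^ k * z1 ^ (n - k)"
proof -
  have 1: "2 * (real n / 2) = real n" and 2: "real n / 2 + (real k - real n / 2) = real k"
    by linarith+
  have "real (n - k) = real n - real k" using assms by (rule of_nat_diff)
  then have 3: "real n / 2 - (real k - real n / 2) = real (n - k)" by linarith
  show ?thesis unfolding psi_def 1 2 3 nat_of_real_of_nat ..
qed

lemma homogeneous_mult:
  fixes a b :: complex
  assumes F: "\<And>x y. F x y = (\<Sum>j\<le>n. C j * x ^ j * y ^ (n - j))"
  shows "\<exists>C'. \<forall>x y. (a * x + b * y) * F x y = (\<Sum>j\<le>Suc n. C' j * x ^ j * y ^ (Suc n - j))"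
proof -
  define C' where "C' j = (if j = 0 then 0 else a * C (j - 1)) + (if j \<le> n then b * C j else 0)" for j
  have "(a * x + b * y) * F x y = (\<Sum>j\<le>Suc n. C' j * x ^ j * y ^ (Suc n - j))" for x y
  proof -
    have "(\<Sum>j\<le>Suc n. (if j = 0 then 0 else a * C (j - 1)) * x ^ j * y ^ (Suc n - j))
        = (\<Sum>j\<le>n. a * C j * x ^ Suc j * y ^ (n - j))"
      by (subst sum.atMost_Suc_shift) simp
    also have "\<dots> = a * x * F x y"
      unfolding F by (simp add: sum_distrib_left mult_ac)
    finally have 1: "(\<Sum>j\<le>Suc n. (if j = 0 then 0 else a * C (j - 1)) * x ^ j * y ^ (Suc n - j))
        = a * x * F x y" .
    have "(\<Sum>j\<le>Suc n. (if j \<le> n then b * C j else 0) * x ^ j * y ^ (Suc n - j))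
        = (\<Sum>j\<le>n. b * C j * x ^ j * y ^ (Suc n - j))"
      by simp
    also have "\<dots> = (\<Sum>j\<le>n. b * y * (C j * x ^ j * y ^ (n - j)))"
      by (intro sum.cong) (auto simp: Suc_diff_le)
    also have "\<dots> = b * y * F x y"
      unfolding F by (simp add: sum_distrib_left)
    finally show ?thesis
      unfolding C'_def ring_distribs sum.distrib 1 by simp
  qed
  then show ?thesis by blast
qed

lemma homogeneous_power_mult:
  fixes a b :: complex
  assumes "\<And>x y. F x y = (\<Sum>j\<le>n. C j * x ^ j * y ^ (n - j))"
  shows "\<exists>C'. \<forall>x y. (a * x + b * y) ^ k * F x y = (\<Sum>j\<le>k + n. C' j * x ^ j * y ^ (k + n - j))"
proof (induction k)
  case 0
  show ?case using assms by auto
next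
  case (Suc k)
  then obtain C' where
    "\<And>x y. (a * x + b * y) ^ k * F x y = (\<Sum>j\<le>k + n. C' j * x ^ j * y ^ (k + n - j))" by blast
  from homogeneous_mult[OF this, of a b] show ?case
    by (simp only: add_Suc power_Suc mult.assoc)
qed

lemma homogeneous_power_power:
  fixes a b c d :: complex
  shows "\<exists>C. \<forall>x y. (a * x + b * y) ^ k * (c * x + d * y) ^ n
    = (\<Sum>j\<le>k + n. C j * x ^ j * y ^ (k + n - j))"
proof -
  have "\<exists>C. \<forall>x y. (c * x + d * y) ^ n * 1 = (\<Sum>j\<le>n + 0. C j * x ^ j * y ^ (n + 0 - j))"
    by (rule homogeneous_power_mult[where C = "\<lambda>_. 1"]) simp
  then obtain C where "\<And>x y. (c * x + d * y) ^ n = (\<Sum>j\<le>n. C j * x ^ j * y ^ (n - j))" by auto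
  from homogeneous_power_mult[OF this] show ?thesis by blast
qed

lemma wigner_exists1:
  assumes "l \<in> half_nats"
  shows "\<exists>!D. is_wigner l g D \<and> (\<forall>m s. m \<notin> idx l \<or> s \<notin> idx l \<longrightarrow> D m s = 0)"
proof -
  obtain n where l: "l = real n / 2" using assms unfolding half_nats_def by auto
  define \<alpha> \<beta> where "\<alpha> = g $ 1 $ 1" and "\<beta> = g $ 2 $ 1"
  define r where "r k = complex_of_real (sqrt (real (n choose k)))" for k
  have r_nz: "r k \<noteq> 0" if "k \<le> n" for k using that unfolding r_def by simp
  define x where "x k = real k - l" for k
  have is_w: "is_wigner l g D \<longleftrightarrow> (\<forall>s\<in>{..n}. \<forall>z0 z1.
      (\<Sum>k\<le>n. r k * z0 ^ k * z1 ^ (n - k) * D (x k) (x s))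
        = r s * (cnj \<alpha> * z0 + cnj \<beta> * z1) ^ s * (- \<beta> * z0 + \<alpha> * z1) ^ (n - s))" for D
  proof -
    have *: "(\<Sum>m\<in>idx l. psi l m z0 z1 * D m t)
        = (\<Sum>k\<le>n. r k * z0 ^ k * z1 ^ (n - k) * D (x k) t)" for z0 z1 t
      unfolding l sum_idx_half x_def r_def by (intro sum.cong) (auto simp: psi_half)
    have **: "psi l (x s) z0 z1 = r s * z0 ^ s * z1 ^ (n - s)" if "s \<in> {..n}" for s z0 z1
      using that unfolding l x_def r_def by (simp add: psi_half)
    have "idx l = x ` {..n}" unfolding l x_def idx_half ..
    then show ?thesis
      unfolding is_wigner_def Let_def * \<alpha>_def[symmetric] \<beta>_def[symmetric] by (simp add: **)
  qed
  have "\<exists>C. \<forall>s\<le>n. \<forall>z0 z1.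
      (cnj \<alpha> * z0 + cnj \<beta> * z1) ^ s * (- \<beta> * z0 + \<alpha> * z1) ^ (n - s)
        = (\<Sum>k\<le>n. C s k * z0 ^ k * z1 ^ (n - k))"
  proof -
    have "\<exists>C. \<forall>z0 z1. (cnj \<alpha> * z0 + cnj \<beta> * z1) ^ s * (- \<beta> * z0 + \<alpha> * z1) ^ (n - s)
        = (\<Sum>k\<le>n. C k * z0 ^ k * z1 ^ (n - k))" if "s \<le> n" for s
      using homogeneous_power_power[of "cnj \<alpha>" "cnj \<beta>" s "- \<beta>" \<alpha> "n - s"] that by simp
    then show ?thesis by metis
  qed
  then obtain C where C: "\<And>s z0 z1. s \<le> n \<Longrightarrow>
      (cnj \<alpha> * z0 + cnj \<beta> * z1) ^ s * (- \<beta> * z0 + \<alpha> * z1) ^ (n - s)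
        = (\<Sum>k\<le>n. C s k * z0 ^ k * z1 ^ (n - k))" by blast
  have idx: "m \<in> idx l \<longleftrightarrow> (\<exists>k\<le>n. m = x k)" for m
    unfolding l x_def idx_half by auto
  define D where "D m s = (if m \<in> idx l \<and> s \<in> idx l
      then r (nat \<lfloor>s + l\<rfloor>) * C (nat \<lfloor>s + l\<rfloor>) (nat \<lfloor>m + l\<rfloor>) / r (nat \<lfloor>m + l\<rfloor>) else 0)" for m s
  have D: "D (x k) (x s) = r s * C s k / r k" if "k \<le> n" "s \<le> n" for k s
    using that idx unfolding D_def x_def by auto
  have "is_wigner l g D"
    unfolding is_w
  proof (intro ballI allI)
    fix s z0 z1 assume s: "s \<in> {..n}"
    have "(\<Sum>k\<le>n. r k * z0 ^ k * z1 ^ (n - k) * D (x k) (x s))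
        = (\<Sum>k\<le>n. r s * (C s k * z0 ^ k * z1 ^ (n - k)))"
      using s by (intro sum.cong) (auto simp: D r_nz)
    also have "\<dots> = r s * ((cnj \<alpha> * z0 + cnj \<beta> * z1) ^ s * (- \<beta> * z0 + \<alpha> * z1) ^ (n - s))"
      using s by (subst C) (auto simp: sum_distrib_left)
    finally show "(\<Sum>k\<le>n. r k * z0 ^ k * z1 ^ (n - k) * D (x k) (x s))
        = r s * (cnj \<alpha> * z0 + cnj \<beta> * z1) ^ s * (- \<beta> * z0 + \<alpha> * z1) ^ (n - s)"
      by (simp add: mult.assoc)
  qed
  moreover have "\<forall>m s. m \<notin> idx l \<or> s \<notin> idx l \<longrightarrow> D m s = 0" unfolding D_def by auto
  moreover have "E = E'"
    if E: "is_wigner l g E" "\<forall>m s. m \<notin> idx l \<or> s \<notin> idx l \<longrightarrow> E m s = 0"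
    and E': "is_wigner l g E'" "\<forall>m s. m \<notin> idx l \<or> s \<notin> idx l \<longrightarrow> E' m s = 0" for E E'
  proof (intro ext)
    fix m s
    show "E m s = E' m s"
    proof (cases "m \<in> idx l \<and> s \<in> idx l")
      case True
      then obtain k t where kt: "k \<le> n" "m = x k" "t \<le> n" "s = x t" using idx by blast
      have "(\<Sum>k\<le>n. r k * z0 ^ k * z1 ^ (n - k) * E (x k) (x t))
          = (\<Sum>k\<le>n. r k * z0 ^ k * z1 ^ (n - k) * E' (x k) (x t))" for z0 z1
        using E(1) E'(1) kt(3) unfolding is_w by simp
      from this[of _ 1] have "\<forall>z. (\<Sum>k\<le>n. (r k * E (x k) (x t)) * z ^ k)
          = (\<Sum>k\<le>n. (r k * E' (x k) (x t)) * z ^ k)"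
        by (simp add: mult_ac)
      then have "r k * E (x k) (x t) = r k * E' (x k) (x t)"
        unfolding polyfun_eq_coeffs using kt by blast
      then show ?thesis using r_nz kt by simp
    qed (use E(2) E'(2) in auto)
  qed
  ultimately show ?thesis by blast
qed

lemma is_wigner_wigner: "l \<in> half_nats \<Longrightarrow> is_wigner l g (wigner l g)"
  unfolding wigner_def using theI'[OF wigner_exists1] by blast

end

theory Submission
  imports Defs
begin

text \<open>
  A matrix \<open>A\<close> with \<open>A = D\<^sup>l(g) A D\<^bsup>l'\<^esup>(g)\<^sup>*\<close> for all \<open>g\<close> in \<open>SU(2)\<close> is encoded in its generating function
  \<open>F(z, w) = \<Sum>m m'. psi l m z * A m m' * cnj (psi l' m' w)\<close>, and the defining relation of the Wigner
  matrices says precisely that \<open>F\<close> is invariant under the diagonal action of \<open>SU(2)\<close> on pairs \<open>(z, w)\<close>.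
  Invariance under the diagonal torus forces \<open>A m m' = 0\<close> unless \<open>m = m'\<close>. Rotating
  \<open>w = (1, 1) / sqrt 2\<close> to \<open>(1, 0)\<close> and comparing coefficients in \<open>z\<close> then shows that \<open>A\<close> is scalar if
  \<open>l = l'\<close> and zero otherwise. This gives the covariances; the case \<open>l' = 0\<close> gives the means, and the
  pseudo-covariances follow since \<open>D\<^sup>l\<close> is equivalent to its complex conjugate.
\<close>

text \<open>Reads the double sum as a polynomial in \<open>x\<close> whose coefficients are
  polynomials in \<open>y\<close>, so that the one-variable comparison applies twice.\<close>

lemma double_polyfun_eq_coeffs:
  fixes C C' :: "nat \<Rightarrow> nat \<Rightarrow> complex"
  assumes eq: "\<And>x y. (\<Sum>k\<le>n. \<Sum>j\<le>m. C k j * x ^ k * y ^ j) = (\<Sum>k\<le>n. \<Sum>j\<le>m. C' k j * x ^ k * y ^ j)"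
    and "k \<le> n" "j \<le> m"
  shows "C k j = C' k j"
proof -
  have "(\<Sum>j\<le>m. C k j * y ^ j) = (\<Sum>j\<le>m. C' k j * y ^ j)" for y
  proof -
    have "(\<Sum>k\<le>n. (\<Sum>j\<le>m. C k j * y ^ j) * x ^ k) = (\<Sum>k\<le>n. (\<Sum>j\<le>m. C' k j * y ^ j) * x ^ k)" for x
      using eq[of x y] by (simp only: sum_distrib_right mult.assoc mult.commute[of "x ^ _"])
    then have "\<forall>x. (\<Sum>k\<le>n. (\<Sum>j\<le>m. C k j * y ^ j) * x ^ k) = (\<Sum>k\<le>n. (\<Sum>j\<le>m. C' k j * y ^ j) * x ^ k)"
      by blast
    then show ?thesis using \<open>k \<le> n\<close> unfolding polyfun_eq_coeffs by blast
  qed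
  then have "\<forall>y. (\<Sum>j\<le>m. C k j * y ^ j) = (\<Sum>j\<le>m. C' k j * y ^ j)"
    by blast
  then show ?thesis using \<open>j \<le> m\<close> unfolding polyfun_eq_coeffs by blast
qed

section \<open>Invariant sesquilinear forms on homogeneous polynomials\<close>

text \<open>Natural-number indexing: \<open>n\<close> stands for \<open>2 * l\<close>, and
  \<open>k\<close> for \<open>l + m\<close>, so the two outer factors are the values of
  \<open>psi\<close>.\<close>

definition sesq_form ::
  "nat \<Rightarrow> nat \<Rightarrow> (nat \<Rightarrow> nat \<Rightarrow> complex) \<Rightarrow> complex \<Rightarrow> complex \<Rightarrow> complex \<Rightarrow> complex \<Rightarrow> complex" where
  "sesq_form n p A z0 z1 w0 w1 =
     (\<Sum>k\<le>n. \<Sum>j\<le>p. (of_real (sqrt (real (n choose k))) * z0 ^ k * z1 ^ (n - k)) * A k j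
        * cnj (of_real (sqrt (real (p choose j))) * w0 ^ j * w1 ^ (p - j)))"

text \<open>The unit vector formed by \<open>\<alpha>\<close> and \<open>\<beta>\<close> is the
  first column of an element \<open>g\<close> of SU(2). The substitution applies the adjoint of
  \<open>g\<close>, that is its inverse, to both points.\<close>

definition sesq_invariant :: "nat \<Rightarrow> nat \<Rightarrow> (nat \<Rightarrow> nat \<Rightarrow> complex) \<Rightarrow> bool" where
  "sesq_invariant n p A \<longleftrightarrow> (\<forall>\<alpha> \<beta> z0 z1 w0 w1. \<alpha> * cnj \<alpha> + \<beta> * cnj \<beta> = 1 \<longrightarrow>
     sesq_form n p A z0 z1 w0 w1 =
     sesq_form n p A (cnj \<alpha> * z0 + cnj \<beta> * z1) (- \<beta> * z0 + \<alpha> * z1)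
                     (cnj \<alpha> * w0 + cnj \<beta> * w1) (- \<beta> * w0 + \<alpha> * w1))"

lemma sesq_form_adjoint:
  "sesq_form p n (\<lambda>j k. cnj (A k j)) w0 w1 z0 z1 = cnj (sesq_form n p A z0 z1 w0 w1)"
  unfolding sesq_form_def by (subst sum.swap) (simp add: mult_ac)

text \<open>Passing to the conjugate transpose exchanges \<open>n\<close> and \<open>p\<close>,
  which reduces the case \<open>p < n\<close> of Schur's lemma to \<open>n < p\<close>.\<close>

lemma sesq_invariant_adjoint:
  assumes "sesq_invariant n p A"
  shows "sesq_invariant p n (\<lambda>j k. cnj (A k j))"
  using assms unfolding sesq_invariant_def sesq_form_adjoint by metis

text \<open>The torus element with \<open>\<alpha> = a\<close>, \<open>\<beta> = 0\<close>
  multiplies the \<open>(k, j)\<close> monomial by \<open>a\<close> to the difference of the two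
  weights \<open>n - 2 * k\<close> and \<open>p - 2 * j\<close>.\<close>

lemma sesq_invariant_weights:
  assumes inv: "sesq_invariant n p A" and k: "k \<le> n" and j: "j \<le> p"
    and N: "int n - 2 * int k \<noteq> int p - 2 * int j"
  shows "A k j = 0"
proof -
  define N where "N = (int n - 2 * int k) - (int p - 2 * int j)"
  \<comment> \<open>Chosen so that \<open>a\<close> to the power \<open>N\<close> is
    \<open>cis pi\<close>, that is \<open>- 1\<close>. The coefficient then equals its own
    negative.\<close>
  define t where "t = pi / of_int N"
  define a where "a = cis t"
  define r where "r n k = complex_of_real (sqrt (real (n choose k)))" for n k
  have [simp]: "r n k \<noteq> 0" if "k \<le> n" for n k using that by (simp add: r_def)
  have "a * cnj a + 0 * cnj 0 = 1" by (simp add: a_def cis_cnj cis_mult)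
  \<comment> \<open>The form is antilinear in the monomials of \<open>w\<close>, so inserting
    \<open>cnj y\<close> gives a polynomial in \<open>x\<close> and \<open>y\<close>.\<close>
  then have eq: "sesq_form n p A x 1 (cnj y) 1
      = sesq_form n p A (cnj a * x) a (cnj a * cnj y) a" for x y
    using inv[unfolded sesq_invariant_def, rule_format, of a 0 x 1 "cnj y" 1] by simp
  have L: "sesq_form n p A x 1 (cnj y) 1 = (\<Sum>k\<le>n. \<Sum>j\<le>p. (r n k * r p j * A k j) * x ^ k * y ^ j)" for x y
    unfolding sesq_form_def r_def by (intro sum.cong) (auto simp: mult_ac)
  have R: "sesq_form n p A (cnj a * x) a (cnj a * cnj y) a
     = (\<Sum>k\<le>n. \<Sum>j\<le>p. (r n k * r p j * A k j * (cnj a ^ k * a ^ (n - k) * a ^ j * cnj a ^ (p - j))) * x ^ k * y ^ j)" for x y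
    unfolding sesq_form_def r_def by (intro sum.cong) (auto simp: mult_ac power_mult_distrib)
  have "r n k * r p j * A k j = r n k * r p j * A k j * (cnj a ^ k * a ^ (n - k) * a ^ j * cnj a ^ (p - j))"
    by (rule double_polyfun_eq_coeffs[OF _ k j]) (use eq L R in simp)
  moreover have "cnj a ^ k * a ^ (n - k) * a ^ j * cnj a ^ (p - j) = - 1"
  proof -
    have "cnj a ^ k * a ^ (n - k) * a ^ j * cnj a ^ (p - j)
        = cis (real k * (- t) + real (n - k) * t + real j * t + real (p - j) * (- t))"
      unfolding a_def cis_cnj Complex.DeMoivre cis_mult ..
    also have "real k * (- t) + real (n - k) * t + real j * t + real (p - j) * (- t) = of_int N * t"
    proof -
      have "real (n - k) = real n - real k" "real (p - j) = real p - real j"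
        using k j by (simp_all add: of_nat_diff)
      then show ?thesis unfolding N_def by (simp add: left_diff_distrib)
    qed
    also have "\<dots> = pi" using N unfolding t_def N_def by simp
    finally show ?thesis by simp
  qed
  ultimately show ?thesis using k j by auto
qed

text \<open>At the point (1, 0) the factor \<open>0 ^ (p - j)\<close> is 1 for \<open>j = p\<close>
  and 0 otherwise, so only the last column of \<open>A\<close> is seen.\<close>

lemma sesq_form_pole:
  "sesq_form n p A z0 z1 1 0 = (\<Sum>k\<le>n. of_real (sqrt (real (n choose k))) * z0 ^ k * z1 ^ (n - k) * A k p)"
proof -
  have "(\<Sum>j\<le>p. x * A k j * cnj (of_real (sqrt (real (p choose j))) * 1 ^ j * 0 ^ (p - j))) = x * A k p" for k x
    by (subst sum.mono_neutral_right[of _ "{p}"]) auto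
  then show ?thesis unfolding sesq_form_def by simp
qed

text \<open>The element with \<open>\<alpha> = \<beta> = s = 1 / sqrt 2\<close> carries
  \<open>(s, s)\<close> to the pole (1, 0). Invariance thus compares a value involving all columns
  with one involving only the last.\<close>

lemma sesq_invariant_diagonal_point:
  assumes inv: "sesq_invariant n p A"
  obtains s :: complex where "s \<noteq> 0" "cnj s = s"
    "\<And>z0 z1. sesq_form n p A z0 z1 s s = sesq_form n p A (s * (z0 + z1)) (s * (z1 - z0)) 1 0"
proof -
  define s where "s = complex_of_real (1 / sqrt 2)"
  have s: "s * s + s * s = 1"
    unfolding s_def of_real_mult[symmetric] of_real_add[symmetric] by simp
  have c: "cnj s = s" by (simp add: s_def)
  have "sesq_form n p A z0 z1 s s = sesq_form n p A (s * (z0 + z1)) (s * (z1 - z0)) 1 0" for z0 z1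
    using inv[unfolded sesq_invariant_def, rule_format, of s s z0 z1 s s] s
    by (simp add: c algebra_simps)
  moreover have "s \<noteq> 0" by (simp add: s_def)
  ultimately show ?thesis using c that by blast
qed

text \<open>Every monomial of degree \<open>p\<close> takes the value \<open>s ^ p\<close> at
  \<open>(s, s)\<close>, so the coefficients in \<open>x\<close> are weighted row sums of
  \<open>A\<close>.\<close>

lemma sesq_form_diagonal_point:
  assumes "cnj s = s"
  shows "sesq_form n p A x 1 s s
    = (\<Sum>k\<le>n. (of_real (sqrt (real (n choose k))) * s ^ p
        * (\<Sum>j\<le>p. A k j * of_real (sqrt (real (p choose j))))) * x ^ k)"
proof -
  have [simp]: "s ^ j * s ^ (p - j) = s ^ p" if "j \<le> p" for j
    using that by (simp flip: power_add)
  have "s ^ j * (s ^ (p - j) * y) = s ^ p * y" if "j \<le> p" for j y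
    using that by (simp flip: mult.assoc)
  then show ?thesis
    unfolding sesq_form_def sum_distrib_left sum_distrib_right
    by (intro sum.cong) (auto simp: assms mult_ac)
qed

text \<open>The weight \<open>- p\<close> of the last column is below all row weights, so that
  column is zero. Hence the form vanishes at the pole, then at \<open>(s, s)\<close>, and all
  weighted row sums are 0. By weights a row has at most one nonzero entry, so this entry vanishes
  too.\<close>

lemma sesq_invariant_less:
  assumes inv: "sesq_invariant n p A" and "n < p" "k \<le> n" "j \<le> p"
  shows "A k j = 0"
proof (cases "int n - 2 * int k = int p - 2 * int j")
  case False
  then show ?thesis using sesq_invariant_weights[OF inv] assms by blast
next
  case True
  obtain s where s: "s \<noteq> 0" "cnj s = s"
    and eq: "\<And>z0 z1. sesq_form n p A z0 z1 s s = sesq_form n p A (s * (z0 + z1)) (s * (z1 - z0)) 1 0"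
    using sesq_invariant_diagonal_point[OF inv] by blast
  have "A k p = 0" if "k \<le> n" for k
    using that \<open>n < p\<close> by (intro sesq_invariant_weights[OF inv]) auto
  then have "sesq_form n p A x 1 s s = 0" for x
    unfolding eq sesq_form_pole by simp
  then have "\<forall>x. (\<Sum>k\<le>n. (of_real (sqrt (real (n choose k))) * s ^ p
        * (\<Sum>j\<le>p. A k j * of_real (sqrt (real (p choose j))))) * x ^ k) = 0"
    unfolding sesq_form_diagonal_point[OF s(2)] by blast
  then have "of_real (sqrt (real (n choose k))) * s ^ p
        * (\<Sum>j\<le>p. A k j * of_real (sqrt (real (p choose j)))) = 0"
    using \<open>k \<le> n\<close> by (subst (asm) polyfun_eq_0) blast
  then have "(\<Sum>j\<le>p. A k j * of_real (sqrt (real (p choose j)))) = 0"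
    using \<open>k \<le> n\<close> s by simp
  also have "(\<Sum>j\<le>p. A k j * of_real (sqrt (real (p choose j)))) = (\<Sum>j\<in>{j}. A k j * of_real (sqrt (real (p choose j))))"
  proof (rule sum.mono_neutral_right)
    show "\<forall>i\<in>{..p} - {j}. A k i * complex_of_real (sqrt (real (p choose i))) = 0"
    proof
      fix i assume "i \<in> {..p} - {j}"
      then have "A k i = 0"
        using True \<open>k \<le> n\<close> by (intro sesq_invariant_weights[OF inv]) auto
      then show "A k i * complex_of_real (sqrt (real (p choose i))) = 0" by simp
    qed
  qed (use \<open>j \<le> p\<close> in auto)
  finally show ?thesis using \<open>j \<le> p\<close> by simp
qed

text \<open>By weights \<open>A\<close> is diagonal. At \<open>(s, s)\<close> the two square roots
  combine to a binomial coefficient in front of \<open>A k k\<close>. The rotated form is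
  \<open>(s * (x + 1)) ^ n * A n n\<close>, and its binomial expansion forces
  \<open>A k k = A n n\<close>.\<close>

lemma sesq_invariant_scalar:
  assumes inv: "sesq_invariant n n A" and k: "k \<le> n" and j: "j \<le> n"
  shows "A k j = (if k = j then A n n else 0)"
proof -
  have off: "A k j = 0" if "k \<noteq> j" "k \<le> n" "j \<le> n" for k j
    using that by (intro sesq_invariant_weights[OF inv]) auto
  obtain s where s: "s \<noteq> 0" "cnj s = s"
    and eq: "\<And>z0 z1. sesq_form n n A z0 z1 s s = sesq_form n n A (s * (z0 + z1)) (s * (z1 - z0)) 1 0"
    using sesq_invariant_diagonal_point[OF inv] by blast
  have sq: "complex_of_real (sqrt (real m)) * complex_of_real (sqrt (real m)) = of_nat m" for m
    unfolding of_real_mult[symmetric] by simp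
  have diag: "(\<Sum>j\<le>n. A k j * of_real (sqrt (real (n choose j)))) = A k k * of_real (sqrt (real (n choose k)))"
    if "k \<le> n" for k
    using that off by (subst sum.mono_neutral_right[of _ "{k}"]) auto
  have "(\<Sum>k\<le>n. (s ^ n * of_nat (n choose k) * A k k) * x ^ k)
      = (\<Sum>k\<le>n. (s ^ n * of_nat (n choose k) * A n n) * x ^ k)" for x
  proof -
    have "(\<Sum>k\<le>n. (s ^ n * of_nat (n choose k) * A k k) * x ^ k) = sesq_form n n A x 1 s s"
      unfolding sesq_form_diagonal_point[OF s(2)]
      by (intro sum.cong) (auto simp: diag sq[symmetric])
    also have "\<dots> = (s * (x + 1)) ^ n * A n n"
      unfolding eq sesq_form_pole using off by (subst sum.mono_neutral_right[of _ "{n}"]) auto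
    also have "\<dots> = (\<Sum>k\<le>n. (s ^ n * of_nat (n choose k) * A n n) * x ^ k)"
      unfolding power_mult_distrib binomial_ring sum_distrib_left sum_distrib_right
      by (simp add: mult_ac)
    finally show ?thesis .
  qed
  then have "\<forall>x. (\<Sum>k\<le>n. (s ^ n * of_nat (n choose k) * A k k) * x ^ k)
      = (\<Sum>k\<le>n. (s ^ n * of_nat (n choose k) * A n n) * x ^ k)" by blast
  then have "s ^ n * of_nat (n choose k) * A k k = s ^ n * of_nat (n choose k) * A n n"
    using k unfolding polyfun_eq_coeffs by blast
  then show ?thesis using off k j s by auto
qed

lemma sesq_invariant_Schur:
  assumes inv: "sesq_invariant n p A" and "k \<le> n" "j \<le> p"
  shows "A k j = (if n = p \<and> k = j then A n n else 0)"
proof -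
  consider "n < p" | "n = p" | "p < n" by linarith
  then show ?thesis
  proof cases
    case 3
    then have "cnj (A k j) = 0"
      using sesq_invariant_less[OF sesq_invariant_adjoint[OF inv]] assms by blast
    then show ?thesis using 3 by simp
  qed (use assms sesq_invariant_less sesq_invariant_scalar in \<open>auto split: if_splits\<close>)
qed

section \<open>Intertwining relations of Wigner matrices\<close>

lemma half_natsE:
  assumes "l \<in> half_nats"
  obtains n where "l = real n / 2"
  using assms unfolding half_nats_def by blast

lemma idx_halfE:
  assumes "m \<in> idx (real n / 2)"
  obtains k where "k \<le> n" "m = real k - real n / 2"
  using assms unfolding idx_half by blast

lemma finite_idx: "l \<in> half_nats \<Longrightarrow> finite (idx l)"
  by (erule half_natsE) (simp only: idx_half finite_imageI finite_atMost)

lemma uminus_in_idx: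
  assumes "l \<in> half_nats" "m \<in> idx l"
  shows "- m \<in> idx l"
proof -
  obtain n where l: "l = real n / 2" using assms(1) by (rule half_natsE)
  obtain k where "k \<le> n" "m = real k - real n / 2" using assms(2) unfolding l by (rule idx_halfE)
  then have "- m = real (n - k) - real n / 2" by (simp add: of_nat_diff)
  then show ?thesis unfolding l idx_half by (rule image_eqI) simp
qed

lemma uminus_idx_bij: "l \<in> half_nats \<Longrightarrow> bij_betw uminus (idx l) (idx l)"
  by (rule bij_betw_byWitness[where f' = uminus]) (auto intro: uminus_in_idx)

lemma sum_idx_uminus:
  "l \<in> half_nats \<Longrightarrow> (\<Sum>m\<in>idx l. f (- m)) = (\<Sum>m\<in>idx l. f m)"
  by (rule sum.reindex_bij_betw[OF uminus_idx_bij])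

lemma card_idx: "l \<in> half_nats \<Longrightarrow> real (card (idx l)) = 2 * l + 1"
  by (erule half_natsE) (simp only: idx_half, simp add: card_image inj_on_def)

section \<open>Complex conjugation of Wigner matrices\<close>

definition idx_sign :: "real \<Rightarrow> real \<Rightarrow> complex" where
  "idx_sign l m = (- 1) ^ nat_of_real (l - m)"

lemma idx_sign_square [simp]: "idx_sign l m * idx_sign l m = 1"
  by (simp add: idx_sign_def flip: power_add mult_2)

lemma cnj_idx_sign [simp]: "cnj (idx_sign l m) = idx_sign l m"
  by (simp add: idx_sign_def)

text \<open>The map swaps the exponents \<open>l + m\<close> and \<open>l - m\<close>, as does
  \<open>m\<close> to \<open>- m\<close>, and binomial coefficients are symmetric. The sign arises
  because \<open>- cnj z1\<close> carries the exponent \<open>l - m\<close>.\<close>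

lemma psi_antipode:
  assumes "l \<in> half_nats" "m \<in> idx l"
  shows "psi l (- m) (- cnj z1) (cnj z0) = idx_sign l m * cnj (psi l m z0 z1)"
proof -
  obtain n where l: "l = real n / 2" using assms(1) by (rule half_natsE)
  obtain k where k: "k \<le> n" "m = real k - real n / 2" using assms(2) unfolding l by (rule idx_halfE)
  then have m': "- m = real (n - k) - real n / 2" and lm: "l - m = real (n - k)"
    using l by (simp_all add: of_nat_diff)
  have "psi l (- m) (- cnj z1) (cnj z0)
      = of_real (sqrt (real (n choose (n - k)))) * (- cnj z1) ^ (n - k) * cnj z0 ^ (n - (n - k))"
    unfolding l m' by (rule psi_half) simp
  moreover have "psi l m z0 z1 = of_real (sqrt (real (n choose k))) * z0 ^ k * z1 ^ (n - k)"
    unfolding l k(2) by (rule psi_half[OF k(1)])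
  moreover have "(- cnj z1) ^ (n - k) = (- 1) ^ (n - k) * cnj z1 ^ (n - k)"
    by (rule power_minus)
  moreover have "idx_sign l m = (- 1) ^ (n - k)"
    unfolding idx_sign_def lm nat_of_real_of_nat ..
  ultimately show ?thesis
    using k(1) by (simp add: binomial_symmetric[symmetric])
qed

lemma wigner_unique:
  assumes "l \<in> half_nats" "is_wigner l g D" "m \<in> idx l" "s \<in> idx l"
  shows "wigner l g m s = D m s"
proof -
  \<comment> \<open>The defining relation sees only entries inside the index range, whereas the
    description of \<open>wigner\<close> demands 0 outside.\<close>
  let ?D = "\<lambda>m s. if m \<in> idx l \<and> s \<in> idx l then D m s else 0"
  have "is_wigner l g ?D"
    using assms(2) unfolding is_wigner_def Let_def by simp
  then have "wigner l g = ?D"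
    unfolding wigner_def by (intro the1_equality[OF wigner_exists1[OF assms(1)]]) auto
  then show ?thesis using assms(3,4) by simp
qed

text \<open>The antiunitary map \<open>(z\<^sub>0, z\<^sub>1) \<mapsto> (- cnj z\<^sub>1, cnj z\<^sub>0)\<close> commutes with \<open>SU(2)\<close>, so every
  \<open>D\<^sup>l\<close> is equivalent to its complex conjugate.\<close>

lemma wigner_cnj:
  assumes l: "l \<in> half_nats" and m: "m \<in> idx l" and s: "s \<in> idx l"
  shows "cnj (wigner l g m s) = idx_sign l m * idx_sign l s * wigner l g (- m) (- s)"
proof -
  define D where "D m s = idx_sign l m * idx_sign l s * cnj (wigner l g (- m) (- s))" for m s
  note neg = uminus_in_idx[OF l]
  have "is_wigner l g D"
    unfolding is_wigner_def Let_def
  proof (intro ballI allI)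
    fix s z0 z1 assume s: "s \<in> idx l"
    let ?\<alpha> = "g $ 1 $ 1" and ?\<beta> = "g $ 2 $ 1"
    have sgn: "idx_sign l m * psi l m z0 z1 = cnj (psi l (- m) (- cnj z1) (cnj z0))" if "m \<in> idx l" for m z0 z1
      unfolding psi_antipode[OF l that] by simp
    have "(\<Sum>m\<in>idx l. psi l m z0 z1 * D m s)
        = (\<Sum>m\<in>idx l. idx_sign l s * cnj (psi l (- m) (- cnj z1) (cnj z0) * wigner l g (- m) (- s)))"
      by (intro sum.cong) (auto simp: D_def sgn[symmetric] mult_ac)
    also have "\<dots> = idx_sign l s * cnj (\<Sum>m\<in>idx l. psi l (- m) (- cnj z1) (cnj z0) * wigner l g (- m) (- s))"
      unfolding cnj_sum sum_distrib_left ..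
    also have "(\<Sum>m\<in>idx l. psi l (- m) (- cnj z1) (cnj z0) * wigner l g (- m) (- s))
        = (\<Sum>m\<in>idx l. psi l m (- cnj z1) (cnj z0) * wigner l g m (- s))"
      by (rule sum_idx_uminus[OF l])
    also have "\<dots> = psi l (- s) (cnj ?\<alpha> * (- cnj z1) + cnj ?\<beta> * cnj z0) (- ?\<beta> * (- cnj z1) + ?\<alpha> * cnj z0)"
      using is_wigner_wigner[OF l, of g] neg[OF s] unfolding is_wigner_def Let_def by blast
    \<comment> \<open>Here the antiunitary map commutes with \<open>g\<close>: the transformed image
      of \<open>(z0, z1)\<close> is the image of the transformed point.\<close>
    also have "\<dots> = psi l (- s) (- cnj (- ?\<beta> * z0 + ?\<alpha> * z1)) (cnj (cnj ?\<alpha> * z0 + cnj ?\<beta> * z1))"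
      by (simp add: algebra_simps)
    also have "\<dots> = idx_sign l s * cnj (psi l s (cnj ?\<alpha> * z0 + cnj ?\<beta> * z1) (- ?\<beta> * z0 + ?\<alpha> * z1))"
      by (rule psi_antipode[OF l s])
    finally show "(\<Sum>m\<in>idx l. psi l m z0 z1 * D m s)
        = psi l s (cnj ?\<alpha> * z0 + cnj ?\<beta> * z1) (- ?\<beta> * z0 + ?\<alpha> * z1)"
      by (simp flip: mult.assoc)
  qed
  from wigner_unique[OF l this m s] show ?thesis
    by (simp add: D_def)
qed

section \<open>The trivial representation and Schur's lemma\<close>

lemma idx_0: "idx 0 = {0}"
  using idx_half[of 0] by simp

lemma zero_half_nats: "0 \<in> half_nats"
  unfolding half_nats_def by (rule CollectI, rule exI[of _ 0]) simp

lemma wigner_0: "wigner 0 g 0 0 = 1"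
proof -
  have "is_wigner 0 g (\<lambda>_ _. 1)"
    unfolding is_wigner_def Let_def idx_0 psi_def nat_of_real_def by simp
  then show ?thesis using wigner_unique[OF zero_half_nats] idx_0 by simp
qed

text \<open>\<open>is_wigner\<close> reads only the first column of \<open>g\<close>; this completes
  a unit vector to an element of \<open>SU2\<close>.\<close>

lemma SU2_intro:
  assumes "\<alpha> * cnj \<alpha> + \<beta> * cnj \<beta> = 1"
  obtains g where "g \<in> SU2" "g $ 1 $ 1 = \<alpha>" "g $ 2 $ 1 = \<beta>"
proof -
  define g :: "complex^2^2" where "g = vector [vector [\<alpha>, - cnj \<beta>], vector [\<beta>, cnj \<alpha>]]"
  have "g \<in> SU2"
    using assms unfolding SU2_def g_def
    by (simp add: det_2 matrix_matrix_mult_def mat_def vec_eq_iff sum_2 forall_2 algebra_simps)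
  then show ?thesis using that by (simp add: g_def)
qed

lemma wigner_Schur:
  assumes l: "l \<in> half_nats" and l': "l' \<in> half_nats"
    and A: "\<And>g m m'. g \<in> SU2 \<Longrightarrow> m \<in> idx l \<Longrightarrow> m' \<in> idx l' \<Longrightarrow>
      A m m' = (\<Sum>s\<in>idx l. \<Sum>s'\<in>idx l'. wigner l g m s * A s s' * cnj (wigner l' g m' s'))"
  shows "\<exists>c. \<forall>m\<in>idx l. \<forall>m'\<in>idx l'. A m m' = (if l = l' \<and> m = m' then c else 0)"
proof -
  obtain n p where n: "l = real n / 2" and p: "l' = real p / 2"
    using l l' by (blast elim: half_natsE)
  define F where "F z0 z1 w0 w1 = (\<Sum>m\<in>idx l. \<Sum>m'\<in>idx l'. psi l m z0 z1 * A m m' * cnj (psi l' m' w0 w1))" for z0 z1 w0 w1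
  define B where "B k j = A (real k - l) (real j - l')" for k j
  have F: "F z0 z1 w0 w1 = sesq_form n p B z0 z1 w0 w1" for z0 z1 w0 w1
    unfolding F_def sesq_form_def B_def n p sum_idx_half
    by (intro sum.cong) (auto simp: psi_half)
  have "sesq_invariant n p B"
    unfolding sesq_invariant_def F[symmetric]
  proof (intro allI impI)
    fix \<alpha> \<beta> z0 z1 w0 w1 :: complex assume "\<alpha> * cnj \<alpha> + \<beta> * cnj \<beta> = 1"
    then obtain g where g: "g \<in> SU2" "g $ 1 $ 1 = \<alpha>" "g $ 2 $ 1 = \<beta>" by (rule SU2_intro)
    have psi: "psi l s (cnj \<alpha> * z0 + cnj \<beta> * z1) (- \<beta> * z0 + \<alpha> * z1) = (\<Sum>m\<in>idx l. psi l m z0 z1 * wigner l g m s)"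
      if "s \<in> idx l" "l \<in> half_nats" for s z0 z1 l
      using is_wigner_wigner[OF that(2), of g] that(1) g(2,3) unfolding is_wigner_def Let_def by simp
    have "F z0 z1 w0 w1 = (\<Sum>m\<in>idx l. \<Sum>m'\<in>idx l'. \<Sum>s\<in>idx l. \<Sum>s'\<in>idx l'.
        psi l m z0 z1 * (wigner l g m s * A s s' * cnj (wigner l' g m' s')) * cnj (psi l' m' w0 w1))"
      unfolding F_def
    proof (intro sum.cong refl)
      fix m m' assume "m \<in> idx l" "m' \<in> idx l'"
      show "psi l m z0 z1 * A m m' * cnj (psi l' m' w0 w1) = (\<Sum>s\<in>idx l. \<Sum>s'\<in>idx l'.
        psi l m z0 z1 * (wigner l g m s * A s s' * cnj (wigner l' g m' s')) * cnj (psi l' m' w0 w1))"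
        by (subst A[OF g(1) \<open>m \<in> idx l\<close> \<open>m' \<in> idx l'\<close>]) (simp only: sum_distrib_left sum_distrib_right)
    qed
    \<comment> \<open>The sums over \<open>m\<close> and \<open>m'\<close> are moved inside, where
      the defining relation evaluates them as \<open>psi\<close> at the rotated points.\<close>
    also have "\<dots> = (\<Sum>m\<in>idx l. \<Sum>s\<in>idx l. \<Sum>m'\<in>idx l'. \<Sum>s'\<in>idx l'.
        psi l m z0 z1 * (wigner l g m s * A s s' * cnj (wigner l' g m' s')) * cnj (psi l' m' w0 w1))"
      by (intro sum.cong refl sum.swap)
    also have "\<dots> = (\<Sum>s\<in>idx l. \<Sum>m\<in>idx l. \<Sum>s'\<in>idx l'. \<Sum>m'\<in>idx l'.
        psi l m z0 z1 * (wigner l g m s * A s s' * cnj (wigner l' g m' s')) * cnj (psi l' m' w0 w1))"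
      by (subst sum.swap) (intro sum.cong refl sum.swap)
    also have "\<dots> = (\<Sum>s\<in>idx l. \<Sum>s'\<in>idx l'. \<Sum>m\<in>idx l. \<Sum>m'\<in>idx l'.
        psi l m z0 z1 * (wigner l g m s * A s s' * cnj (wigner l' g m' s')) * cnj (psi l' m' w0 w1))"
      by (intro sum.cong refl sum.swap)
    also have "\<dots> = (\<Sum>s\<in>idx l. \<Sum>s'\<in>idx l'. (\<Sum>m\<in>idx l. psi l m z0 z1 * wigner l g m s) * A s s'
        * cnj (\<Sum>m'\<in>idx l'. psi l' m' w0 w1 * wigner l' g m' s'))"
      by (intro sum.cong refl) (simp add: sum_distrib_left sum_distrib_right mult_ac)
    also have "\<dots> = F (cnj \<alpha> * z0 + cnj \<beta> * z1) (- \<beta> * z0 + \<alpha> * z1) (cnj \<alpha> * w0 + cnj \<beta> * w1) (- \<beta> * w0 + \<alpha> * w1)"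
      unfolding F_def by (intro sum.cong refl) (simp only: psi l l')
    finally show "F z0 z1 w0 w1 = F (cnj \<alpha> * z0 + cnj \<beta> * z1) (- \<beta> * z0 + \<alpha> * z1)
      (cnj \<alpha> * w0 + cnj \<beta> * w1) (- \<beta> * w0 + \<alpha> * w1)" .
  qed
  from sesq_invariant_Schur[OF this]
  have B: "B k j = (if n = p \<and> k = j then B n n else 0)" if "k \<le> n" "j \<le> p" for k j using that by blast
  have "A m m' = (if l = l' \<and> m = m' then B n n else 0)" if "m \<in> idx l" "m' \<in> idx l'" for m m'
  proof -
    have "m \<in> idx (real n / 2)" "m' \<in> idx (real p / 2)"
      using that unfolding n p .
    then obtain k j where k: "k \<le> n" "m = real k - l" and j: "j \<le> p" "m' = real j - l'"
      unfolding n p by (elim idx_halfE) blast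
    have "A m m' = B k j" unfolding B_def k j ..
    also have "\<dots> = (if n = p \<and> k = j then B n n else 0)" by (rule B[OF k(1) j(1)])
    also have "n = p \<and> k = j \<longleftrightarrow> l = l' \<and> m = m'" unfolding k j n p by auto
    finally show ?thesis .
  qed
  then show ?thesis by blast
qed

text \<open>Reflecting the second index and inserting the sign of \<open>eps\<close> turns the
  second Wigner matrix into its conjugate by \<open>wigner_cnj\<close>. The matrix \<open>B\<close>
  then satisfies the hypothesis of \<open>wigner_Schur\<close>; undoing the reflection moves the
  diagonal to the antidiagonal.\<close>

lemma wigner_Schur_bilinear:
  assumes l: "l \<in> half_nats" and l': "l' \<in> half_nats"
    and A: "\<And>g m m'. g \<in> SU2 \<Longrightarrow> m \<in> idx l \<Longrightarrow> m' \<in> idx l' \<Longrightarrow>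
      A m m' = (\<Sum>s\<in>idx l. \<Sum>s'\<in>idx l'. wigner l g m s * A s s' * wigner l' g m' s')"
  shows "\<exists>c. \<forall>m\<in>idx l. \<forall>m'\<in>idx l'. A m m' = (if l = l' \<and> m' = - m then idx_sign l m * c else 0)"
proof -
  define B where "B m m' = A m (- m') * idx_sign l' m'" for m m'
  note neg = uminus_in_idx[OF l']
  have "\<exists>c. \<forall>m\<in>idx l. \<forall>m'\<in>idx l'. B m m' = (if l = l' \<and> m = m' then c else 0)"
  proof (rule wigner_Schur[OF l l'])
    fix g m m' assume g: "g \<in> SU2" and m: "m \<in> idx l" and m': "m' \<in> idx l'"
    have "B m m' = (\<Sum>s\<in>idx l. \<Sum>s'\<in>idx l'. wigner l g m s * A s s' * wigner l' g (- m') s') * idx_sign l' m'"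
      unfolding B_def by (subst A[OF g m neg[OF m']]) simp
    also have "\<dots> = (\<Sum>s\<in>idx l. \<Sum>s'\<in>idx l'. wigner l g m s * A s (- s') * wigner l' g (- m') (- s')) * idx_sign l' m'"
      by (intro arg_cong2[where f = "(*)"] sum.cong refl sum_idx_uminus[OF l', symmetric])
    also have "\<dots> = (\<Sum>s\<in>idx l. \<Sum>s'\<in>idx l'. wigner l g m s * B s s' * cnj (wigner l' g m' s'))"
      unfolding sum_distrib_right
    proof (intro sum.cong refl)
      fix s s' assume s': "s' \<in> idx l'"
      have "idx_sign l' s' * cnj (wigner l' g m' s') = idx_sign l' m' * wigner l' g (- m') (- s') * (idx_sign l' s' * idx_sign l' s')"
        unfolding wigner_cnj[OF l' m' s'] by (simp only: mult_ac)
      then show "wigner l g m s * A s (- s') * wigner l' g (- m') (- s') * idx_sign l' m'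
          = wigner l g m s * B s s' * cnj (wigner l' g m' s')"
        by (simp add: B_def mult_ac)
    qed
    finally show "B m m' = (\<Sum>s\<in>idx l. \<Sum>s'\<in>idx l'. wigner l g m s * B s s' * cnj (wigner l' g m' s'))" .
  qed
  then obtain c where c: "\<And>m m'. m \<in> idx l \<Longrightarrow> m' \<in> idx l' \<Longrightarrow> B m m' = (if l = l' \<and> m = m' then c else 0)"
    by blast
  have "A m m' = (if l = l' \<and> m' = - m then idx_sign l m * c else 0)" if m: "m \<in> idx l" and m': "m' \<in> idx l'" for m m'
  proof -
    have "A m m' = B m (- m') * idx_sign l' (- m')"
      unfolding B_def by (simp add: mult.assoc)
    then show ?thesis using c[OF m neg[OF m']] by auto
  qed
  then show ?thesis by blast
qed

text \<open>A fixed vector is a one-column intertwiner with the trivial representation, so Schur's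
  lemma applies with \<open>l' = 0\<close>.\<close>

lemma wigner_fixed_vector:
  assumes l: "l \<in> half_nats" "l \<noteq> 0" and m: "m \<in> idx l"
    and v: "\<And>g m. g \<in> SU2 \<Longrightarrow> m \<in> idx l \<Longrightarrow> v m = mat_vec l (wigner l g) v m"
  shows "v m = 0"
proof -
  have "\<exists>c. \<forall>m\<in>idx l. \<forall>m'\<in>idx 0. v m = (if l = 0 \<and> m = m' then c else 0)"
  proof (rule wigner_Schur[OF l(1) zero_half_nats])
    fix g m and m' :: real assume g: "g \<in> SU2" and m: "m \<in> idx l" and "m' \<in> idx 0"
    then show "v m = (\<Sum>s\<in>idx l. \<Sum>s'\<in>idx 0. wigner l g m s * v s * cnj (wigner 0 g m' s'))"
      using v[OF g m] by (simp add: idx_0 wigner_0 mat_vec_def)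
  qed
  then show ?thesis using l m idx_0 by auto
qed

section \<open>Second moments of random vectors\<close>

lemma integrable_mult_of_square_integrable:
  fixes f g :: "'w \<Rightarrow> complex"
  assumes [measurable]: "f \<in> borel_measurable M" "g \<in> borel_measurable M"
    and f: "integrable M (\<lambda>w. (cmod (f w))\<^sup>2)" and g: "integrable M (\<lambda>w. (cmod (g w))\<^sup>2)"
  shows "integrable M (\<lambda>w. f w * g w)"
proof (rule Bochner_Integration.integrable_bound)
  show "integrable M (\<lambda>w. (cmod (f w))\<^sup>2 + (cmod (g w))\<^sup>2)" using f g by simp
  have "cmod (f w * g w) \<le> (cmod (f w))\<^sup>2 + (cmod (g w))\<^sup>2" for w
  proof -
    have "0 \<le> (cmod (f w) - cmod (g w))\<^sup>2" by simp
    moreover have "0 \<le> cmod (f w) * cmod (g w)" by simp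
    ultimately show ?thesis unfolding norm_mult power2_diff by linarith
  qed
  then show "AE w in M. norm (f w * g w) \<le> norm ((cmod (f w))\<^sup>2 + (cmod (g w))\<^sup>2)"
    by simp
qed simp

lemma integral_mult_linear_combinations:
  fixes U :: "'w \<Rightarrow> 'a \<Rightarrow> complex" and W :: "'w \<Rightarrow> 'b \<Rightarrow> complex"
  assumes "\<And>s t. s \<in> S \<Longrightarrow> t \<in> T \<Longrightarrow> integrable M (\<lambda>w. U w s * W w t)"
  shows "(LINT w|M. (\<Sum>s\<in>S. a s * U w s) * (\<Sum>t\<in>T. b t * W w t))
    = (\<Sum>s\<in>S. \<Sum>t\<in>T. a s * (LINT w|M. U w s * W w t) * b t)"
proof -
  have "(LINT w|M. (\<Sum>s\<in>S. a s * U w s) * (\<Sum>t\<in>T. b t * W w t))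
      = (LINT w|M. (\<Sum>s\<in>S. \<Sum>t\<in>T. a s * b t * (U w s * W w t)))"
    by (simp add: sum_product mult_ac)
  also have "\<dots> = (\<Sum>s\<in>S. \<Sum>t\<in>T. a s * b t * (LINT w|M. U w s * W w t))"
    using assms by simp
  finally show ?thesis by (simp add: mult_ac)
qed

lemma hinner_basis_vec:
  assumes "finite (idx l)" "k \<in> idx l"
  shows "hinner l (basis_vec k) v = v k"
  unfolding hinner_def basis_vec_def
  using assms by (subst sum.mono_neutral_right[of _ "{k}"]) auto

section \<open>Moments of an invariant family\<close>

locale D_invariant_family = prob_space M
  for M :: "'w measure" and I :: "'i set" and l :: "'i \<Rightarrow> real"
    and V :: "'i \<Rightarrow> 'w \<Rightarrow> real \<Rightarrow> complex" +
  assumes half: "\<And>i. i \<in> I \<Longrightarrow> l i \<in> half_nats"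
    and second_order: "\<And>i. i \<in> I \<Longrightarrow> second_order_random_vector M (idx (l i)) (V i)"
    and invariant: "two_weakly_D_invariant M I l V"
begin

lemma integrable_mult:
  assumes "i \<in> I" "j \<in> I" "m \<in> idx (l i)" "m' \<in> idx (l j)"
  shows "integrable M (\<lambda>w. V i w m * V j w m')"
    and "integrable M (\<lambda>w. V i w m * cnj (V j w m'))"
proof -
  have "(\<lambda>w. V i w m) \<in> borel_measurable M" "(\<lambda>w. V j w m') \<in> borel_measurable M"
    and "integrable M (\<lambda>w. (cmod (V i w m))\<^sup>2)" "integrable M (\<lambda>w. (cmod (V j w m'))\<^sup>2)"
    using assms second_order unfolding second_order_random_vector_def by auto
  moreover from this(2) have "(\<lambda>w. cnj (V j w m')) \<in> borel_measurable M"
    by (rule borel_measurable_continuous_on[rotated]) (intro continuous_intros)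
  ultimately show "integrable M (\<lambda>w. V i w m * V j w m')"
    and "integrable M (\<lambda>w. V i w m * cnj (V j w m'))"
    by (auto intro!: integrable_mult_of_square_integrable)
qed

text \<open>Pairs the component with the constant 1, which is square integrable on a probability
  space.\<close>

lemma integrable_component:
  assumes "i \<in> I" "m \<in> idx (l i)"
  shows "integrable M (\<lambda>w. V i w m)"
proof -
  have "(\<lambda>w. V i w m) \<in> borel_measurable M" "integrable M (\<lambda>w. (cmod (V i w m))\<^sup>2)"
    using assms second_order unfolding second_order_random_vector_def by auto
  then have "integrable M (\<lambda>w. V i w m * 1)"
    by (intro integrable_mult_of_square_integrable) auto
  then show ?thesis by simp
qed

lemma equiv_rotated:
  assumes "i \<in> I" "j \<in> I" "g \<in> SU2"
  shows "two_weakly_equiv M M (idx (l i) <+> idx (l j))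
    (\<lambda>w. case_sum (V i w) (V j w))
    (\<lambda>w. case_sum (mat_vec (l i) (wigner (l i) g) (V i w)) (mat_vec (l j) (wigner (l j) g) (V j w)))"
  using invariant assms unfolding two_weakly_D_invariant_def by blast

lemma mean_zero:
  assumes i: "i \<in> I" "l i \<noteq> 0" and m: "m \<in> idx (l i)"
  shows "(LINT w|M. V i w m) = 0"
proof (rule wigner_fixed_vector[where v = "\<lambda>m. LINT w|M. V i w m", OF half[OF i(1)] i(2) m])
  fix g m assume g: "g \<in> SU2" and m: "m \<in> idx (l i)"
  then have "Inl m \<in> idx (l i) <+> idx (l i)" by blast
  from equiv_rotated[OF i(1) i(1) g, unfolded two_weakly_equiv_def, THEN conjunct1, rule_format, OF this]
  have "(LINT w|M. V i w m) = (LINT w|M. mat_vec (l i) (wigner (l i) g) (V i w) m)"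
    by simp
  then show "(LINT w|M. V i w m) = mat_vec (l i) (wigner (l i) g) (\<lambda>m. LINT w|M. V i w m) m"
    unfolding mat_vec_def using integrable_component[OF i(1)] by simp
qed

text \<open>The moment between the \<open>Inl\<close> and \<open>Inr\<close> parts of the joint
  vector is the cross moment of \<open>V i\<close> and \<open>V j\<close>; invariance makes it an
  intertwiner.\<close>

lemma covariance_structure:
  assumes i: "i \<in> I" and j: "j \<in> I"
  shows "\<exists>c. \<forall>m\<in>idx (l i). \<forall>m'\<in>idx (l j).
    (LINT w|M. V i w m * cnj (V j w m')) = (if l i = l j \<and> m = m' then c else 0)"
proof (rule wigner_Schur[OF half[OF i] half[OF j]])
  fix g m m' assume g: "g \<in> SU2" and m: "m \<in> idx (l i)" and m': "m' \<in> idx (l j)"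
  then have "Inl m \<in> idx (l i) <+> idx (l j)" "Inr m' \<in> idx (l i) <+> idx (l j)" by blast+
  from equiv_rotated[OF i j g, unfolded two_weakly_equiv_def, THEN conjunct2, THEN conjunct1, rule_format, OF this]
  have "(LINT w|M. V i w m * cnj (V j w m'))
      = (LINT w|M. mat_vec (l i) (wigner (l i) g) (V i w) m * cnj (mat_vec (l j) (wigner (l j) g) (V j w) m'))"
    by simp
  also have "\<dots> = (\<Sum>s\<in>idx (l i). \<Sum>s'\<in>idx (l j). wigner (l i) g m s
      * (LINT w|M. V i w s * cnj (V j w s')) * cnj (wigner (l j) g m' s'))"
    unfolding mat_vec_def cnj_sum complex_cnj_mult
    using integrable_mult(2)[OF i j] by (rule integral_mult_linear_combinations)
  finally show "(LINT w|M. V i w m * cnj (V j w m')) = (\<Sum>s\<in>idx (l i). \<Sum>s'\<in>idx (l j). wigner (l i) g m s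
      * (LINT w|M. V i w s * cnj (V j w s')) * cnj (wigner (l j) g m' s'))" .
qed

lemma pseudo_covariance_structure:
  assumes i: "i \<in> I" and j: "j \<in> I"
  shows "\<exists>c. \<forall>m\<in>idx (l i). \<forall>m'\<in>idx (l j).
    (LINT w|M. V i w m * V j w m') = (if l i = l j \<and> m' = - m then idx_sign (l i) m * c else 0)"
proof (rule wigner_Schur_bilinear[OF half[OF i] half[OF j]])
  fix g m m' assume g: "g \<in> SU2" and m: "m \<in> idx (l i)" and m': "m' \<in> idx (l j)"
  then have "Inl m \<in> idx (l i) <+> idx (l j)" "Inr m' \<in> idx (l i) <+> idx (l j)" by blast+
  from equiv_rotated[OF i j g, unfolded two_weakly_equiv_def, THEN conjunct2, THEN conjunct2, rule_format, OF this]
  have "(LINT w|M. V i w m * V j w m')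
      = (LINT w|M. mat_vec (l i) (wigner (l i) g) (V i w) m * mat_vec (l j) (wigner (l j) g) (V j w) m')"
    by simp
  also have "\<dots> = (\<Sum>s\<in>idx (l i). \<Sum>s'\<in>idx (l j). wigner (l i) g m s
      * (LINT w|M. V i w s * V j w s') * wigner (l j) g m' s')"
    unfolding mat_vec_def
    using integrable_mult(1)[OF i j] by (rule integral_mult_linear_combinations)
  finally show "(LINT w|M. V i w m * V j w m') = (\<Sum>s\<in>idx (l i). \<Sum>s'\<in>idx (l j). wigner (l i) g m s
      * (LINT w|M. V i w s * V j w s') * wigner (l j) g m' s')" .
qed

text \<open>The trace determines the constant of Schur's lemma: each of the
  \<open>2 * l i + 1\<close> diagonal entries equals \<open>c\<close>.\<close>

lemma covariance_identity:
  assumes i: "i \<in> I" and j: "j \<in> I" and m: "m \<in> idx (l i)" "m' \<in> idx (l j)"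
  shows "(LINT w|M. V i w m * cnj (V j w m'))
    = of_bool (l i = l j) / of_real (2 * l i + 1) * id_mat m m' * (LINT w|M. cnj (hinner (l i) (V i w) (V j w)))"
proof -
  obtain c where c: "\<And>m m'. m \<in> idx (l i) \<Longrightarrow> m' \<in> idx (l j) \<Longrightarrow>
      (LINT w|M. V i w m * cnj (V j w m')) = (if l i = l j \<and> m = m' then c else 0)"
    using covariance_structure[OF i j] by blast
  have "(LINT w|M. cnj (hinner (l i) (V i w) (V j w))) = of_real (2 * l i + 1) * c" if eq: "l i = l j"
  proof -
    have "(LINT w|M. cnj (hinner (l i) (V i w) (V j w))) = (LINT w|M. (\<Sum>k\<in>idx (l i). V i w k * cnj (V j w k)))"
      unfolding hinner_def by simp
    also have "\<dots> = (\<Sum>k\<in>idx (l i). LINT w|M. V i w k * cnj (V j w k))"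
      by (rule Bochner_Integration.integral_sum) (use integrable_mult(2)[OF i j] eq in simp)
    also have "\<dots> = (\<Sum>k\<in>idx (l i). c)"
      using c eq by simp
    also have "\<dots> = of_real (real (card (idx (l i)))) * c" by simp
    finally show ?thesis unfolding card_idx[OF half[OF i]] .
  qed
  moreover have "of_real (2 * l i + 1) \<noteq> (0::complex)"
    using half[OF i] unfolding of_real_eq_0_iff by (auto elim!: half_natsE)
  ultimately show ?thesis using c[OF m] by (cases "l i = l j") (simp_all add: id_mat_def)
qed

text \<open>A signed antidiagonal trace determines \<open>c\<close>. The exponent
  \<open>l i - k\<close> matches that of \<open>eps\<close>, so the signs cancel in each summand;
  with \<open>l i + k\<close> the sum would change sign for proper half-integers.\<close>

lemma pseudo_covariance_identity:
  assumes i: "i \<in> I" and j: "j \<in> I" and m: "m \<in> idx (l i)" "m' \<in> idx (l j)"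
  shows "(LINT w|M. V i w m * V j w m')
    = of_bool (l i = l j) / of_real (2 * l i + 1) * eps (l i) m m'
      * (\<Sum>k\<in>idx (l i). (- 1) ^ nat_of_real (l i - k)
          * (LINT w|M. hinner (l i) (basis_vec k) (V i w) * hinner (l j) (basis_vec (- k)) (V j w)))"
proof -
  obtain c where c: "\<And>m m'. m \<in> idx (l i) \<Longrightarrow> m' \<in> idx (l j) \<Longrightarrow>
      (LINT w|M. V i w m * V j w m') = (if l i = l j \<and> m' = - m then idx_sign (l i) m * c else 0)"
    using pseudo_covariance_structure[OF i j] by blast
  have "(\<Sum>k\<in>idx (l i). (- 1) ^ nat_of_real (l i - k)
          * (LINT w|M. hinner (l i) (basis_vec k) (V i w) * hinner (l j) (basis_vec (- k)) (V j w)))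
      = of_real (2 * l i + 1) * c" if eq: "l i = l j"
  proof -
    have "(- 1) ^ nat_of_real (l i - k)
          * (LINT w|M. hinner (l i) (basis_vec k) (V i w) * hinner (l j) (basis_vec (- k)) (V j w)) = c"
      if k: "k \<in> idx (l i)" for k
    proof -
      have k': "- k \<in> idx (l j)" using k uminus_in_idx half[OF i] eq by simp
      show ?thesis
        unfolding hinner_basis_vec[OF finite_idx[OF half[OF i]] k] hinner_basis_vec[OF finite_idx[OF half[OF j]] k']
          c[OF k k'] idx_sign_def[symmetric]
        using eq by (simp flip: mult.assoc)
    qed
    then have "(\<Sum>k\<in>idx (l i). (- 1) ^ nat_of_real (l i - k)
          * (LINT w|M. hinner (l i) (basis_vec k) (V i w) * hinner (l j) (basis_vec (- k)) (V j w)))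
        = of_real (real (card (idx (l i)))) * c" by simp
    then show ?thesis unfolding card_idx[OF half[OF i]] .
  qed
  moreover have "of_real (2 * l i + 1) \<noteq> (0::complex)"
    using half[OF i] unfolding of_real_eq_0_iff by (auto elim!: half_natsE)
  ultimately show ?thesis using c[OF m] by (cases "l i = l j") (simp_all add: eps_def idx_sign_def)
qed

section \<open>From moments to correlations\<close>

text \<open>Allows vanishing moments to be read as vanishing covariances. Both means can be nonzero
  only if \<open>l i = l j = 0\<close>, and then 0 is the only index, which is its own
  reflection.\<close>

lemma mean_product_zero:
  assumes "i \<in> I" "j \<in> I" "m \<in> idx (l i)" "m' \<in> idx (l j)" "l i = l j \<Longrightarrow> m \<noteq> m' \<or> m' \<noteq> - m"
  shows "(LINT w|M. V i w m) = 0 \<or> (LINT w|M. V j w m') = 0"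
proof (cases "l i = 0 \<and> l j = 0")
  case True
  then show ?thesis using assms(3-5) by (simp add: idx_0)
next
  case False
  then show ?thesis using mean_zero assms(1-4) by blast
qed

lemma covar_zero:
  assumes "i \<in> I" "j \<in> I" "m \<in> idx (l i)" "m' \<in> idx (l j)" "l i = l j \<Longrightarrow> m \<noteq> m'"
  shows "covar M (\<lambda>w. V i w m) (\<lambda>w. V j w m') = 0"
proof -
  obtain c where "\<And>m m'. m \<in> idx (l i) \<Longrightarrow> m' \<in> idx (l j) \<Longrightarrow>
      (LINT w|M. V i w m * cnj (V j w m')) = (if l i = l j \<and> m = m' then c else 0)"
    using covariance_structure[OF assms(1,2)] by blast
  note this[OF assms(3,4)]
  also have "(if l i = l j \<and> m = m' then c else 0) = 0"
    using assms(5) by (intro if_not_P) blast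
  finally have "(LINT w|M. V i w m * cnj (V j w m')) = 0" .
  moreover have "(LINT w|M. V i w m) = 0 \<or> (LINT w|M. V j w m') = 0"
    by (rule mean_product_zero[OF assms(1-4)]) (use assms(5) in blast)
  ultimately show ?thesis unfolding covar_def by auto
qed

lemma pseudo_covar_zero:
  assumes "i \<in> I" "j \<in> I" "m \<in> idx (l i)" "m' \<in> idx (l j)" "l i = l j \<Longrightarrow> m' \<noteq> - m"
  shows "pseudo_covar M (\<lambda>w. V i w m) (\<lambda>w. V j w m') = 0"
proof -
  obtain c where "\<And>m m'. m \<in> idx (l i) \<Longrightarrow> m' \<in> idx (l j) \<Longrightarrow>
      (LINT w|M. V i w m * V j w m') = (if l i = l j \<and> m' = - m then idx_sign (l i) m * c else 0)"
    using pseudo_covariance_structure[OF assms(1,2)] by blast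
  note this[OF assms(3,4)]
  also have "(if l i = l j \<and> m' = - m then idx_sign (l i) m * c else 0) = 0"
    using assms(5) by (intro if_not_P) blast
  finally have "(LINT w|M. V i w m * V j w m') = 0" .
  moreover have "(LINT w|M. V i w m) = 0 \<or> (LINT w|M. V j w m') = 0"
    by (rule mean_product_zero[OF assms(1-4)]) (use assms(5) in blast)
  ultimately show ?thesis unfolding pseudo_covar_def by auto
qed

lemma uncorrelated_components:
  assumes "i \<in> I" "j \<in> I" "m \<in> idx (l i)" "m' \<in> idx (l j)" "l i = l j \<Longrightarrow> m' \<noteq> m \<and> m' \<noteq> - m"
  shows "uncorrelated M (\<lambda>w. V i w m) (\<lambda>w. V j w m')"
proof -
  have "covar M (\<lambda>w. V i w m) (\<lambda>w. V j w m') = 0"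
    by (rule covar_zero[OF assms(1-4)]) (use assms(5) in blast)
  moreover have "pseudo_covar M (\<lambda>w. V i w m) (\<lambda>w. V j w m') = 0"
    by (rule pseudo_covar_zero[OF assms(1-4)]) (use assms(5) in blast)
  ultimately show ?thesis unfolding covar_def pseudo_covar_def uncorrelated_def by simp
qed

text \<open>For equal nonzero degrees the means vanish and the moment is constant on the diagonal.
  In degree 0 the mean may survive, but there is only one index; for different degrees both sides
  are 0.\<close>

lemma covar_diagonal:
  assumes i: "i \<in> I" and j: "j \<in> I"
    and m: "m \<in> idx (l i) \<inter> idx (l j)" and n: "n \<in> idx (l i) \<inter> idx (l j)"
  shows "covar M (\<lambda>w. V i w m) (\<lambda>w. V j w m) = covar M (\<lambda>w. V i w n) (\<lambda>w. V j w n)"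
proof (cases "l i = l j \<and> l i \<noteq> 0")
  case True
  obtain c where "\<And>m m'. m \<in> idx (l i) \<Longrightarrow> m' \<in> idx (l j) \<Longrightarrow>
      (LINT w|M. V i w m * cnj (V j w m')) = (if l i = l j \<and> m = m' then c else 0)"
    using covariance_structure[OF i j] by blast
  then show ?thesis using m n True mean_zero[OF i] unfolding covar_def by auto
next
  case False
  then consider "l i = 0" "l j = 0" | "l i \<noteq> l j" by fastforce
  then show ?thesis
  proof cases
    case 1
    then show ?thesis using m n by (simp add: idx_0)
  next
    case 2
    then show ?thesis using covar_zero[OF i j] m n by simp
  qed
qed

text \<open>Along the antidiagonal the moment is a constant times
  \<open>(- 1) ^ nat_of_real (l i - m)\<close>, which is where parity enters.\<close>

lemma pseudo_covar_antidiagonal: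
  assumes i: "i \<in> I" and j: "j \<in> I"
    and m: "m \<in> idx (l i) \<inter> idx (l j)" and n: "n \<in> idx (l i) \<inter> idx (l j)"
    and parity: "even (nat_of_real (l i - m)) = even (nat_of_real (l i - n))"
  shows "pseudo_covar M (\<lambda>w. V i w m) (\<lambda>w. V j w (- m)) = pseudo_covar M (\<lambda>w. V i w n) (\<lambda>w. V j w (- n))"
proof (cases "l i = l j \<and> l i \<noteq> 0")
  case True
  obtain c where c: "\<And>m m'. m \<in> idx (l i) \<Longrightarrow> m' \<in> idx (l j) \<Longrightarrow>
      (LINT w|M. V i w m * V j w m') = (if l i = l j \<and> m' = - m then idx_sign (l i) m * c else 0)"
    using pseudo_covariance_structure[OF i j] by blast
  have "idx_sign (l i) m = idx_sign (l i) n"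
    using parity unfolding idx_sign_def by (simp add: minus_one_power_iff)
  then show ?thesis
    using m n True mean_zero[OF i] c uminus_in_idx[OF half[OF j]] unfolding pseudo_covar_def by auto
next
  case False
  then consider "l i = 0" "l j = 0" | "l i \<noteq> l j" by fastforce
  then show ?thesis
  proof cases
    case 1
    then show ?thesis using m n by (simp add: idx_0)
  next
    case 2
    then show ?thesis using pseudo_covar_zero[OF i j] uminus_in_idx[OF half[OF j]] m n by simp
  qed
qed

text \<open>The variance, embedded in the complex numbers, is the covariance of a component with
  itself, so \<open>covar_diagonal\<close> applies with \<open>j = i\<close>.\<close>

lemma variance_component:
  assumes i: "i \<in> I" and m: "m \<in> idx (l i)" and n: "n \<in> idx (l i)"
  shows "complex_variance M (\<lambda>w. V i w m) = complex_variance M (\<lambda>w. V i w n)"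
proof -
  have "of_real (complex_variance M (\<lambda>w. V i w m)) = covar M (\<lambda>w. V i w m) (\<lambda>w. V i w m)"
    if m: "m \<in> idx (l i)" for m
  proof -
    define a where "a = (LINT w|M. V i w m)"
    note int = integrable_component[OF i m] integrable_mult(2)[OF i i m m]
    have "of_real (complex_variance M (\<lambda>w. V i w m)) = (LINT w|M. complex_of_real ((cmod (V i w m - a))\<^sup>2))"
      unfolding complex_variance_def a_def integral_complex_of_real ..
    also have "\<dots> = (LINT w|M. V i w m * cnj (V i w m) - V i w m * cnj a - a * cnj (V i w m) + a * cnj a)"
      unfolding complex_norm_square by (simp add: algebra_simps)
    also have "\<dots> = (LINT w|M. V i w m * cnj (V i w m)) - a * cnj a - a * cnj a + a * cnj a"
      using int by (simp add: prob_space a_def)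
    finally show ?thesis unfolding covar_def a_def by simp
  qed
  then have "of_real (complex_variance M (\<lambda>w. V i w m)) = complex_of_real (complex_variance M (\<lambda>w. V i w n))"
    using covar_diagonal[OF i i, of m n] m n by simp
  then show ?thesis by (simp only: of_real_eq_iff)
qed

end

theorem theorem57:
  fixes M :: "'w measure" and I :: "'i set" and l :: "'i \<Rightarrow> real"
    and V :: "'i \<Rightarrow> 'w \<Rightarrow> real \<Rightarrow> complex"
  assumes "prob_space M"
    and "\<And>i. i \<in> I \<Longrightarrow> l i \<in> half_nats"
    and "\<And>i. i \<in> I \<Longrightarrow> second_order_random_vector M (idx (l i)) (V i)"
    and "two_weakly_D_invariant M I l V"
  shows "(\<forall>i\<in>I. l i \<noteq> 0 \<longrightarrow> (\<forall>m\<in>idx (l i). (LINT w|M. V i w m) = 0))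
    \<and> (\<forall>i\<in>I. \<forall>j\<in>I. \<forall>m\<in>idx (l i). \<forall>m'\<in>idx (l j).
        (LINT w|M. V i w m * cnj (V j w m'))
          = of_bool (l i = l j) / of_real (2 * l i + 1) * id_mat m m'
            * (LINT w|M. cnj (hinner (l i) (V i w) (V j w))))
    \<and> (\<forall>i\<in>I. \<forall>j\<in>I. \<forall>m\<in>idx (l i). \<forall>m'\<in>idx (l j).
        (LINT w|M. V i w m * V j w m')
          = of_bool (l i = l j) / of_real (2 * l i + 1) * eps (l i) m m'
            * (\<Sum>k\<in>idx (l i). (- 1) ^ nat_of_real (l i - k)
                * (LINT w|M. hinner (l i) (basis_vec k) (V i w)
                           * hinner (l j) (basis_vec (- k)) (V j w))))
    \<and> (\<forall>i\<in>I. \<forall>j\<in>I. l i \<noteq> l j \<longrightarrow> uncorrelated_vec M (idx (l i)) (idx (l j)) (V i) (V j))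
    \<and> (\<forall>i\<in>I. \<forall>j\<in>I. \<forall>m\<in>idx (l i). \<forall>m'\<in>idx (l j). m' \<noteq> m \<and> m' \<noteq> - m \<longrightarrow>
        uncorrelated M (\<lambda>w. V i w m) (\<lambda>w. V j w m'))
    \<and> (\<forall>i\<in>I. \<forall>j\<in>I. \<forall>m\<in>idx (l i) \<inter> idx (l j). \<forall>n\<in>idx (l i) \<inter> idx (l j).
        even (nat_of_real (l i - m)) = even (nat_of_real (l i - n)) \<longrightarrow>
          covar M (\<lambda>w. V i w m) (\<lambda>w. V j w m) = covar M (\<lambda>w. V i w n) (\<lambda>w. V j w n)
        \<and> pseudo_covar M (\<lambda>w. V i w m) (\<lambda>w. V j w (- m))
            = pseudo_covar M (\<lambda>w. V i w n) (\<lambda>w. V j w (- n))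
        \<and> (m \<noteq> 0 \<and> n \<noteq> 0 \<longrightarrow>
            covar M (\<lambda>w. V i w m) (\<lambda>w. V j w (- m)) = covar M (\<lambda>w. V i w n) (\<lambda>w. V j w (- n))
          \<and> pseudo_covar M (\<lambda>w. V i w m) (\<lambda>w. V j w m)
              = pseudo_covar M (\<lambda>w. V i w n) (\<lambda>w. V j w n)))
    \<and> (\<forall>i\<in>I. \<forall>m\<in>idx (l i). \<forall>n\<in>idx (l i).
        complex_variance M (\<lambda>w. V i w m) = complex_variance M (\<lambda>w. V i w n))"
proof -
  interpret D_invariant_family M I l V
    using assms by (intro D_invariant_family.intro D_invariant_family_axioms.intro) auto
  show ?thesis
  proof (intro conjI ballI impI)
    fix i j m n
    assume i: "i \<in> I" and j: "j \<in> I" and m: "m \<in> idx (l i) \<inter> idx (l j)" and n: "n \<in> idx (l i) \<inter> idx (l j)"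
    have neg: "- m \<in> idx (l j)" "- n \<in> idx (l j)"
      using m n uminus_in_idx[OF half[OF j]] by auto
    assume "m \<noteq> 0 \<and> n \<noteq> 0"
    \<comment> \<open>Away from index 0 the diagonal and antidiagonal are disjoint, so all four
      correlations below vanish.\<close>
    then have "m \<noteq> - m" "n \<noteq> - n" by auto
    then show "covar M (\<lambda>w. V i w m) (\<lambda>w. V j w (- m)) = covar M (\<lambda>w. V i w n) (\<lambda>w. V j w (- n))"
      and "pseudo_covar M (\<lambda>w. V i w m) (\<lambda>w. V j w m) = pseudo_covar M (\<lambda>w. V i w n) (\<lambda>w. V j w n)"
      using m n neg by (simp_all add: covar_zero[OF i j] pseudo_covar_zero[OF i j])
  next
    fix i j assume "i \<in> I" "j \<in> I" "l i \<noteq> l j"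
    then show "uncorrelated_vec M (idx (l i)) (idx (l j)) (V i) (V j)"
      unfolding uncorrelated_vec_def by (auto intro: uncorrelated_components)
  next
    fix i j m m' assume "i \<in> I" "j \<in> I" "m \<in> idx (l i)" "m' \<in> idx (l j)" "m' \<noteq> m \<and> m' \<noteq> - m"
    then show "uncorrelated M (\<lambda>w. V i w m) (\<lambda>w. V j w m')"
      by (intro uncorrelated_components) simp_all
  qed (rule mean_zero covariance_identity pseudo_covariance_identity covar_diagonal
        pseudo_covar_antidiagonal variance_component; assumption)+
qed

end
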